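(* Let $0<\alpha<1$ and $0<q<1$, and for $n\in\mathbb{N}_0$ let $$\tilde{\phi}_{\alpha,q}(n)=\prod_{k=1}^{n}\frac{1-q^{\alpha+k-1}}{1-q^{k}}.$$ Then $$\lim_{n\to\infty}\tilde{\phi}_{\alpha,q}(n)=C_q:=\frac{(q^\alpha;q)_\infty}{(q;q)_\infty}>0,$$ and more precisely $\tilde{\phi}_{\alpha,q}(n)=C_q+O(q^n)$ as $n\to\infty$.
   Context: For $|q|<1$ and $b\in\mathbb{C}$, $(b;q)_\infty=\prod_{k=0}^{\infty}(1-bq^k)$ is the infinite $q$-Pochhammer symbol. The sequence $\tilde\phi_{\alpha,q}(n)=\binom{n+\alpha-1}{n}_q$ is the $q$-deformed memory kernel (Gaussian binomial coefficient). The implied constant in $O(q^n)$ may depend on $q$ and $\alpha$. *)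

theory Defs
  imports "HOL-Analysis.Analysis" "HOL-Library.Landau_Symbols"
begin

text \<open>
  The infinite \<open>q\<close>-Pochhammer symbol \<open>(b;q)\<^sub>\<infinity>\<close>, meaningful for \<open>norm q < 1\<close>. It is stated for
  any normed field so that real and complex arguments are covered by one definition.
\<close>

definition qpochhammer_inf :: "'a::real_normed_field \<Rightarrow> 'a \<Rightarrow> 'a" where
  "qpochhammer_inf b q = (\<Prod>k. 1 - b * q ^ k)"

lemma has_prod_qpochhammer_inf:
  fixes b q :: "'a::{real_normed_field, banach}"
  assumes "norm q < 1"
  shows "(\<lambda>k. 1 - b * q ^ k) has_prod qpochhammer_inf b q"
proof -
  have "summable (\<lambda>k. norm (b * q ^ k))"
    using assms by (simp add: norm_mult norm_power summable_mult)
  then have "abs_convergent_prod (\<lambda>k. 1 - b * q ^ k)"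
    by (intro summable_imp_abs_convergent_prod) simp
  then show ?thesis
    unfolding qpochhammer_inf_def
    by (intro convergent_prod_has_prod abs_convergent_prod_imp_convergent_prod)
qed

text \<open>
  The \<open>q\<close>-deformed memory kernel, i.e. the Gaussian binomial coefficient of \<open>n + \<alpha> - 1\<close> over \<open>n\<close>.
\<close>

definition qkernel :: "real \<Rightarrow> real \<Rightarrow> nat \<Rightarrow> real" where
  "qkernel \<alpha> q n = (\<Prod>k=1..n. (1 - q powr (\<alpha> + real k - 1)) / (1 - q ^ k))"

end

theory Submission
  imports Defs
begin

text \<open>
  With \<open>a = q\<^sup>\<alpha>\<close>, the kernel is the quotient of the partial products of \<open>(a;q)\<^sub>\<infinity>\<close> and
  \<open>(q;q)\<^sub>\<infinity>\<close>. Both infinite products converge, and their values are positive because all factors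
  are: a convergent infinite product vanishes only if one of its factors does. Hence the limit and its positivity (\<open>qpochhammer_inf_pos\<close>, \<open>qkernel_tendsto\<close>).

  For the rate, \<open>0 < \<alpha> < 1\<close> means \<open>q < a < 1\<close>, so every factor of the kernel is less than
  \<open>1\<close> and the kernel is a decreasing sequence bounded by \<open>1\<close>. One step lowers it by at most
  \<open>q\<^sup>n (a - q) / (1 - q\<^sup>n\<^sup>+\<^sup>1) \<le> q\<^sup>n\<close> (\<open>qkernel_step\<close>). Adding up these steps as a geometric
  series gives \<open>0 \<le> qkernel \<alpha> q n - C \<le> q\<^sup>n / (1 - q)\<close>.
\<close>

lemma qpochhammer_inf_pos:
  fixes b q :: real
  assumes "b < 1" "0 \<le> q" "q < 1"
  shows "qpochhammer_inf b q > 0"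
proof -
  have pos: "1 - b * q ^ k > 0" for k
  proof (cases "b \<le> 0")
    case True
    then have "b * q ^ k \<le> 0"
      using assms by (simp add: mult_nonpos_nonneg)
    then show ?thesis by simp
  next
    case False
    then have "b * q ^ k \<le> b * 1"
      using assms by (intro mult_left_mono power_le_one) auto
    then show ?thesis using assms by simp
  qed
  show ?thesis
    by (rule has_prod_pos[OF has_prod_qpochhammer_inf pos]) (use assms in auto)
qed

lemma qkernel_eq_quotient:
  fixes \<alpha> q :: real
  assumes "0 < q"
  shows "qkernel \<alpha> q n = (\<Prod>k<n. 1 - q powr \<alpha> * q ^ k) / (\<Prod>k<n. 1 - q * q ^ k)"
proof -
  have "qkernel \<alpha> q n = (\<Prod>k<n. (1 - q powr (\<alpha> + real (Suc k) - 1)) / (1 - q ^ Suc k))"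
    unfolding qkernel_def by (rule prod.reindex_bij_witness[of _ Suc "\<lambda>k. k - 1"]) auto
  also have "\<dots> = (\<Prod>k<n. (1 - q powr \<alpha> * q ^ k) / (1 - q * q ^ k))"
    using assms by (intro prod.cong) (auto simp: powr_add powr_realpow)
  finally show ?thesis by (simp add: prod_dividef)
qed

lemma qkernel_tendsto:
  fixes \<alpha> q :: real
  assumes "0 < q" "q < 1"
  shows "qkernel \<alpha> q \<longlonglongrightarrow> qpochhammer_inf (q powr \<alpha>) q / qpochhammer_inf q q"
proof -
  have "qpochhammer_inf q q \<noteq> 0"
    using qpochhammer_inf_pos[of q q] assms by simp
  then have "(\<lambda>n. (\<Prod>k<n. 1 - q powr \<alpha> * q ^ k) / (\<Prod>k<n. 1 - q * q ^ k))
      \<longlonglongrightarrow> qpochhammer_inf (q powr \<alpha>) q / qpochhammer_inf q q"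
    using assms by (intro tendsto_divide has_prod_imp_tendsto' has_prod_qpochhammer_inf) auto
  moreover have "qkernel \<alpha> q = (\<lambda>n. (\<Prod>k<n. 1 - q powr \<alpha> * q ^ k) / (\<Prod>k<n. 1 - q * q ^ k))"
    using assms by (intro ext qkernel_eq_quotient)
  ultimately show ?thesis by simp
qed

text \<open>
  Writing \<open>a = q\<^sup>\<alpha>\<close> and \<open>f\<close> for the new factor, \<open>1 - f = q\<^sup>n (a - q) / (1 - q\<^sup>n\<^sup>+\<^sup>1)\<close>, where
  \<open>q \<le> a \<le> 1\<close>; hence \<open>0 \<le> 1 - f \<le> q\<^sup>n\<close>. The upper bound on the step also needs the kernel to
  be at most \<open>1\<close>, which holds for a product of factors in \<open>[0,1]\<close>.
\<close>

lemma qkernel_step: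
  fixes \<alpha> q :: real
  assumes "0 \<le> \<alpha>" "\<alpha> \<le> 1" "0 < q" "q < 1"
  shows "qkernel \<alpha> q (Suc n) \<le> qkernel \<alpha> q n"
    and "qkernel \<alpha> q n - qkernel \<alpha> q (Suc n) \<le> q ^ n"
proof -
  define a where "a = q powr \<alpha>"
  define f where "f k = (1 - a * q ^ k) / (1 - q * q ^ k)" for k
  have a: "q \<le> a" "a \<le> 1"
    using assms powr_mono'[of \<alpha> 1 q] powr_mono'[of 0 \<alpha> q] by (auto simp: a_def)
  have f: "0 \<le> 1 - f k" "1 - f k \<le> q ^ k" "0 \<le> f k" for k
  proof -
    have qk: "0 < q ^ k" "q ^ k \<le> 1"
      using assms by (auto intro: power_le_one)
    then have "q * q ^ k \<le> q" "a * q ^ k \<le> 1"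
      using assms a by (auto intro: mult_left_le mult_le_one)
    then have den: "1 - q \<le> 1 - q * q ^ k" "0 < 1 - q * q ^ k"
      using \<open>q < 1\<close> by linarith+
    have eq: "1 - f k = q ^ k * ((a - q) / (1 - q * q ^ k))"
      using den by (simp add: f_def field_simps)
    show "0 \<le> 1 - f k"
      unfolding eq using a den qk by simp
    have "(a - q) / (1 - q * q ^ k) \<le> 1"
      using a den by (simp add: divide_le_eq)
    then show "1 - f k \<le> q ^ k"
      unfolding eq using qk by (intro mult_left_le) auto
    show "0 \<le> f k"
      unfolding f_def using \<open>a * q ^ k \<le> 1\<close> den by simp
  qed
  have eq: "qkernel \<alpha> q m = (\<Prod>k<m. f k)" for m
    using assms by (simp add: qkernel_eq_quotient f_def a_def prod_dividef)
  have K: "0 \<le> qkernel \<alpha> q n" "qkernel \<alpha> q n \<le> 1"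
    unfolding eq using f by (auto intro!: prod_nonneg prod_le_1)
  have step: "qkernel \<alpha> q n - qkernel \<alpha> q (Suc n) = qkernel \<alpha> q n * (1 - f n)"
    by (simp add: eq algebra_simps)
  show "qkernel \<alpha> q (Suc n) \<le> qkernel \<alpha> q n"
    using step K f(1)[of n] by (metis diff_ge_0_iff_ge mult_nonneg_nonneg)
  show "qkernel \<alpha> q n - qkernel \<alpha> q (Suc n) \<le> q ^ n"
    unfolding step using mult_mono[OF K(2) f(2)[of n]] f(1)[of n] by simp
qed

theorem mainTheorem2:
  fixes \<alpha> q C :: real
  assumes "0 < \<alpha>" and "\<alpha> < 1" and "0 < q" and "q < 1"
  defines "C \<equiv> qpochhammer_inf (q powr \<alpha>) q / qpochhammer_inf q q"
  shows "qkernel \<alpha> q \<longlonglongrightarrow> C \<and> C > 0 \<and> (\<lambda>n. qkernel \<alpha> q n - C) \<in> O(\<lambda>n. q ^ n)"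
proof (intro conjI)
  show lim: "qkernel \<alpha> q \<longlonglongrightarrow> C"
    unfolding C_def using assms by (intro qkernel_tendsto)
  have "q powr \<alpha> < 1"
    using assms powr_less_mono'[of q 0 \<alpha>] by simp
  then show "C > 0"
    unfolding C_def using assms by (intro divide_pos_pos qpochhammer_inf_pos) auto
  have lower: "C \<le> qkernel \<alpha> q n" for n
    using assms by (intro decseq_ge[OF _ lim] decseq_SucI qkernel_step) auto
  \<comment> \<open>Subtracting the geometric tail \<open>q\<^sup>n + q\<^sup>n\<^sup>+\<^sup>1 + \<dots>\<close> turns the decreasing kernel into an
    increasing sequence with the same limit, so that \<open>C\<close> is also bounded from below.\<close>
  define g where "g n = qkernel \<alpha> q n - q ^ n / (1 - q)" for n
  have "incseq g"
  proof (rule incseq_SucI)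
    fix n
    have "q ^ n / (1 - q) - q ^ Suc n / (1 - q) = q ^ n"
      using assms by (simp add: diff_divide_distrib[symmetric] divide_eq_eq algebra_simps)
    then show "g n \<le> g (Suc n)"
      using qkernel_step(2)[of \<alpha> q n] assms by (simp add: g_def)
  qed
  moreover have "g \<longlonglongrightarrow> C"
  proof -
    have "(\<lambda>n. qkernel \<alpha> q n - q ^ n / (1 - q)) \<longlonglongrightarrow> C - 0 / (1 - q)"
      using assms by (intro tendsto_diff lim tendsto_divide LIMSEQ_power_zero tendsto_const) auto
    then show ?thesis by (simp add: g_def[abs_def])
  qed
  ultimately have upper: "g n \<le> C" for n
    by (rule incseq_le)
  show "(\<lambda>n. qkernel \<alpha> q n - C) \<in> O(\<lambda>n. q ^ n)"
  proof (rule bigoI[of _ "1 / (1 - q)"], rule always_eventually, rule allI)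
    fix n
    show "norm (qkernel \<alpha> q n - C) \<le> 1 / (1 - q) * norm (q ^ n)"
      using lower[of n] upper[of n] assms by (simp add: g_def)
  qed
qed

end
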